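(* Let $N\ge 1$, let $u_0\in L^1(\mathbb{R}^N)$ and let $M=\int_{\mathbb{R}^N} u_0(x)\,dx$. Let $u(t)=u(\cdot,t)$ be the solution of the heat equation $\partial_t u=\Delta u$ in $\mathbb{R}^N\times(0,\infty)$ with initial data $u_0$, and let $G_t$ be the Gaussian heat kernel. Then $$\lim_{t\to\infty}\|u(t)-M G_t\|_{L^1(\mathbb{R}^N)}=0,$$ $$\lim_{t\to\infty}t^{N/2}\|u(t)-M G_t\|_{L^\infty(\mathbb{R}^N)}=0,$$ and, for every $1\le p\le\infty$, $$\lim_{t\to\infty}t^{N(p-1)/(2p)}\|u(t)-M G_t\|_{L^p(\mathbb{R}^N)}=0,$$ where for $p=\infty$ the exponent $N(p-1)/(2p)$ is read as $N/2$.
   Context: The Gaussian heat kernel is $G_t(x)=(4\pi t)^{-N/2}e^{-|x|^2/(4t)}$ for $x\in\mathbb{R}^N$, $t>0$. The solution of the heat equation $\partial_t u=\Delta u$ in $\mathbb{R}^N\times(0,\infty)$ with initial data $u_0$ is the one given by the representation formula $u(x,t)=(G_t*u_0)(x)=\int_{\mathbb{R}^N}G_t(x-y)u_0(y)\,dy$. The function $u_0$ is real-valued and may change sign; $M$ may be any real number. *)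

theory Defs
  imports "HOL-Analysis.Analysis" "HOL-Probability.Essential_Supremum"
begin

text \<open>
  \<open>\<real>\<^sup>N\<close> is an arbitrary \<open>'a::euclidean_space\<close> with \<open>N = DIM('a)\<close>, which is positive for
  every instance of the class.
\<close>

definition heat_kernel :: "real \<Rightarrow> 'a::euclidean_space \<Rightarrow> real" where
  "heat_kernel t x = (4 * pi * t) powr (- (real DIM('a) / 2)) * exp (- (norm x)\<^sup>2 / (4 * t))"

text \<open>
  The solution of the heat equation with initial data \<open>u0\<close> is the one given by the
  representation formula \<open>u(\<cdot>,t) = G\<^sub>t * u0\<close>; it is meant for \<open>t > 0\<close>.
\<close>

definition heat_solution :: "('a::euclidean_space \<Rightarrow> real) \<Rightarrow> real \<Rightarrow> 'a \<Rightarrow> real" where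
  "heat_solution u0 t x = (LINT y|lebesgue. heat_kernel t (x - y) * u0 y)"

text \<open>
  The \<open>L\<^sup>p\<close> norm for \<open>1 \<le> p \<le> \<infinity>\<close>, with values in \<open>[0,\<infinity>]\<close>: it is finite exactly
  when \<open>f\<close> is measurable and belongs to \<open>L\<^sup>p\<close>. There is no real power on \<open>ennreal\<close>, so
  the \<open>p\<close>-th root is taken on the reals.
\<close>

definition Lp_norm :: "'a measure \<Rightarrow> ennreal \<Rightarrow> ('a \<Rightarrow> real) \<Rightarrow> ennreal" where
  "Lp_norm M p f =
     (if f \<notin> borel_measurable M then \<infinity>
      else if p = \<infinity> then esssup M (\<lambda>x. ennreal \<bar>f x\<bar>)
      else if (\<integral>\<^sup>+x. ennreal (\<bar>f x\<bar> powr enn2real p) \<partial>M) < \<infinity>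
      then ennreal (enn2real (\<integral>\<^sup>+x. ennreal (\<bar>f x\<bar> powr enn2real p) \<partial>M) powr (1 / enn2real p))
      else \<infinity>)"

definition decay_exponent :: "nat \<Rightarrow> ennreal \<Rightarrow> real" where
  "decay_exponent N p =
     (if p = \<infinity> then real N / 2
      else real N * (enn2real p - 1) / (2 * enn2real p))"

end

theory Submission
  imports Defs "HOL-Probability.Distributions"
begin

text \<open>
  Since \<open>u(x,t) - M G\<^sub>t(x) = \<integral> (G\<^sub>t(x - y) - G\<^sub>t(x)) u\<^sub>0(y) dy\<close> and \<open>G\<^sub>t\<close> is a rescaling of \<open>G\<^sub>1\<close> by
  \<open>\<surd>t\<close>, both the \<open>L\<^sup>1\<close> norm and \<open>t\<close> to the power \<open>N/2\<close> times the sup norm are at most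
  \<open>\<integral> W(y / \<surd>t) \<bar>u\<^sub>0(y)\<bar> dy\<close>, where \<open>W(z)\<close> is the \<open>L\<^sup>1\<close> norm of \<open>G\<^sub>1(\<cdot> - z) - G\<^sub>1\<close>, respectively a bound
  \<open>min 1 \<bar>z\<bar>\<close> for its sup norm. In both cases \<open>W\<close> is bounded and tends to \<open>0\<close> at the origin, so dominated
  convergence gives the endpoint cases \<open>p = 1\<close> and \<open>p = \<infinity>\<close>; the others follow by interpolation.
\<close>

section \<open>Pointwise estimates for the heat kernel\<close>

lemma heat_kernel_measurable [measurable]:
  "heat_kernel t \<in> borel_measurable borel"
  unfolding heat_kernel_def[abs_def] by measurable

lemma heat_kernel_nonneg: "0 \<le> heat_kernel t x"
  by (simp add: heat_kernel_def)

lemma heat_kernel_bounded: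
  fixes x :: "'a::euclidean_space"
  assumes "t > 0"
  shows "heat_kernel t x \<le> (4 * pi * t) powr (- (real DIM('a) / 2))"
  using assms by (simp add: heat_kernel_def mult_left_le)

text \<open>This prefactor is the maximum of the kernel at time 1. Bounding it by 1 keeps
  dimensional constants out of the estimates below.\<close>

lemma four_pi_powr_le_1: "(4 * pi) powr (- (real n / 2)) \<le> 1"
proof -
  have "1 \<le> 4 * pi" using pi_gt3 by simp
  then have "1 \<le> (4 * pi) powr (real n / 2)" by (intro ge_one_powr_ge_zero) auto
  then show ?thesis by (simp add: powr_minus inverse_le_1_iff)
qed

lemma heat_kernel_scaling:
  fixes x :: "'a::euclidean_space"
  assumes "t > 0"
  shows "heat_kernel t x = t powr (- (real DIM('a) / 2)) * heat_kernel 1 (x /\<^sub>R sqrt t)"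
  using assms
  by (simp add: heat_kernel_def powr_mult power_mult_distrib power_inverse field_simps)

text \<open>Mean value inequality: on the half line the profile exp(-r^2/4) has a derivative of
  absolute value (r/2) exp(-r^2/4), which is at most 1.\<close>

lemma abs_exp_minus_sq_diff_le:
  fixes a b :: real
  assumes "0 \<le> a" "0 \<le> b"
  shows "\<bar>exp (- a\<^sup>2 / 4) - exp (- b\<^sup>2 / 4)\<bar> \<le> \<bar>a - b\<bar>"
proof -
  have "norm (exp (- a\<^sup>2 / 4) - exp (- b\<^sup>2 / 4)) \<le> 1 * norm (a - b)"
  proof (rule field_differentiable_bound[where S="{0..}" and f'="\<lambda>r. exp (- r\<^sup>2 / 4) * (- r / 2)"])
    fix r :: real assume "r \<in> {0..}"
    show "((\<lambda>r. exp (- r\<^sup>2 / 4)) has_field_derivative exp (- r\<^sup>2 / 4) * (- r / 2)) (at r within {0..})"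
      by (auto intro!: derivative_eq_intros simp: power2_eq_square)
    \<comment> \<open>Expanding the square gives r <= 1 + r^2/4, hence the same for r/2 since r >=
      0.\<close>
    have "0 \<le> (r / 2 - 1)\<^sup>2" by simp
    then have "r / 2 \<le> 1 + r\<^sup>2 / 4"
      using \<open>r \<in> {0..}\<close> by (simp add: power2_diff power_divide)
    also have "\<dots> \<le> exp (r\<^sup>2 / 4)" by (rule exp_ge_add_one_self)
    finally show "norm (exp (- r\<^sup>2 / 4) * (- r / 2)) \<le> 1"
      using \<open>r \<in> {0..}\<close> by (simp add: abs_mult exp_minus field_simps)
  qed (use assms in auto)
  then show ?thesis by simp
qed

text \<open>Both values lie in [0,1], which gives the bound 1. The bound \<open>norm z\<close> comes
  from the Lipschitz estimate for the radial profile and the reverse triangle inequality.\<close>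

lemma heat_kernel_1_diff_le:
  fixes x z :: "'a::euclidean_space"
  shows "\<bar>heat_kernel 1 (x - z) - heat_kernel 1 x\<bar> \<le> min 1 (norm z)"
proof -
  define K where "K = (4 * pi) powr (- (real DIM('a) / 2))"
  have K: "0 \<le> K" "K \<le> 1" unfolding K_def by (simp, rule four_pi_powr_le_1)
  have g: "0 \<le> heat_kernel 1 y" "heat_kernel 1 y \<le> 1" for y :: 'a
    using heat_kernel_nonneg[of 1 y] heat_kernel_bounded[of 1 y] K by (auto simp: K_def)
  have "\<bar>heat_kernel 1 (x - z) - heat_kernel 1 x\<bar>
      = K * \<bar>exp (- (norm (x - z))\<^sup>2 / 4) - exp (- (norm x)\<^sup>2 / 4)\<bar>"
    using K(1) by (simp add: heat_kernel_def K_def flip: right_diff_distrib abs_mult)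
       (simp add: abs_mult)
  also have "\<dots> \<le> 1 * \<bar>norm (x - z) - norm x\<bar>"
    using K by (intro mult_mono abs_exp_minus_sq_diff_le) auto
  also have "\<dots> \<le> norm z"
    using norm_triangle_ineq3[of "x - z" x] by simp
  finally show ?thesis using g[of "x - z"] g[of x] by auto
qed

section \<open>Integrability of Gaussians and translation invariance\<close>

lemma integrable_gaussian_euclidean:
  fixes c :: real
  assumes "c > 0"
  shows "integrable lborel (\<lambda>x::'a::euclidean_space. exp (- c * (norm x)\<^sup>2))"
proof (rule integrableI_bounded)
  \<comment> \<open>The standard deviation for which the centred normal density is a constant
    multiple of exp(-c x^2).\<close>
  define s where "s = 1 / sqrt (2 * c)"
  have s: "s > 0" "1 / (2 * s\<^sup>2) = c" using assms by (auto simp: s_def power_divide)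
  have "integrable lborel (\<lambda>x. sqrt (2 * pi * s\<^sup>2) * normal_density 0 s x)"
    using s(1) by (intro integrable_mult_right integrable_normal_density)
  also have "(\<lambda>x. sqrt (2 * pi * s\<^sup>2) * normal_density 0 s x) = (\<lambda>x. exp (- c * x\<^sup>2))"
    using s by (auto simp: normal_density_def fun_eq_iff field_simps)
  finally have 1: "integrable lborel (\<lambda>x::real. exp (- c * x\<^sup>2))" .
  \<comment> \<open>The Gaussian factors over the coordinates, so its integral is a product of
    finite one-dimensional ones.\<close>
  have "ennreal (norm (exp (- c * (norm x)\<^sup>2))) = (\<Prod>b\<in>Basis. ennreal (exp (- c * (x \<bullet> b)\<^sup>2)))"
    for x :: 'a
  proof -
    have "(norm x)\<^sup>2 = (\<Sum>b\<in>Basis. (x \<bullet> b)\<^sup>2)"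
      unfolding power2_norm_eq_inner by (subst euclidean_inner) (simp add: power2_eq_square)
    then show ?thesis by (simp add: prod_ennreal sum_distrib_left sum_negf flip: exp_sum)
  qed
  then have "(\<integral>\<^sup>+x. ennreal (norm (exp (- c * (norm (x::'a))\<^sup>2))) \<partial>lborel)
      = (\<integral>\<^sup>+x. (\<Prod>b\<in>Basis. ennreal (exp (- c * (x \<bullet> b)\<^sup>2))) \<partial>(lborel :: 'a measure))"
    by simp
  also have "\<dots> = (\<Prod>b\<in>(Basis :: 'a set). \<integral>\<^sup>+x. ennreal (exp (- c * x\<^sup>2)) \<partial>lborel)"
    by (rule nn_integral_lborel_prod) auto
  also have "\<dots> < \<infinity>"
    using nn_integral_eq_integral[OF 1] by (simp add: power_less_top_ennreal)
  finally show "(\<integral>\<^sup>+x. ennreal (norm (exp (- c * (norm (x::'a))\<^sup>2))) \<partial>lborel) < \<infinity>" .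
qed simp

lemma integrable_heat_kernel:
  assumes "t > 0"
  shows "integrable lborel (heat_kernel t :: 'a::euclidean_space \<Rightarrow> real)"
proof -
  have "integrable lborel (\<lambda>x::'a. (4 * pi * t) powr (- (real DIM('a) / 2)) *
      exp (- (1 / (4 * t)) * (norm x)\<^sup>2))"
    using integrable_gaussian_euclidean[of "1 / (4 * t)"] assms by simp
  then show ?thesis by (simp add: heat_kernel_def[abs_def] field_simps)
qed

lemma lborel_translation:
  fixes f :: "'a::euclidean_space \<Rightarrow> real"
  assumes "integrable lborel f"
  shows "integrable lborel (\<lambda>x. f (x - z))"
    and "(LINT x|lborel. f (x - z)) = (LINT x|lborel. f x)"
proof -
  have [measurable]: "f \<in> borel_measurable borel" using assms by auto
  have "integrable (distr lborel borel ((+) (- z))) f"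
    using assms by (simp add: lborel_distr_plus)
  then show "integrable lborel (\<lambda>x. f (x - z))"
    by (subst (asm) integrable_distr_eq) auto
  have "(LINT x|distr lborel borel ((+) (- z)). f x) = (LINT x|lborel. f (x - z))"
    by (subst integral_distr) auto
  then show "(LINT x|lborel. f (x - z)) = (LINT x|lborel. f x)"
    by (simp add: lborel_distr_plus)
qed

section \<open>The L1 modulus of continuity of the kernel at time 1\<close>

definition heat_L1_modulus :: "'a::euclidean_space \<Rightarrow> real" where
  "heat_L1_modulus z = (LINT x|lborel. \<bar>heat_kernel 1 (x - z) - heat_kernel 1 x\<bar>)"

lemma heat_L1_modulus_measurable [measurable]: "heat_L1_modulus \<in> borel_measurable borel"
  unfolding heat_L1_modulus_def[abs_def] by measurable

lemma integrable_heat_kernel_diff: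
  fixes z :: "'a::euclidean_space"
  shows "integrable lborel (\<lambda>x. \<bar>heat_kernel 1 (x - z) - heat_kernel 1 x\<bar>)"
  by (intro integrable_abs Bochner_Integration.integrable_diff lborel_translation integrable_heat_kernel) auto

lemma heat_L1_modulus_nonneg: "0 \<le> heat_L1_modulus z"
  by (simp add: heat_L1_modulus_def)

text \<open>Triangle inequality and translation invariance: each of the two kernels contributes its
  total mass.\<close>

lemma heat_L1_modulus_bounded:
  fixes z :: "'a::euclidean_space"
  shows "\<bar>heat_L1_modulus z\<bar> \<le> 2 * (LINT x|lborel. heat_kernel 1 (x::'a))"
proof -
  note i = integrable_heat_kernel[of 1, where 'a='a, simplified]
  have "heat_L1_modulus z \<le> (LINT x|lborel. heat_kernel 1 (x - z) + heat_kernel 1 x)"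
    unfolding heat_L1_modulus_def
    by (intro integral_mono integrable_heat_kernel_diff Bochner_Integration.integrable_add lborel_translation i)
       (simp add: abs_le_iff heat_kernel_nonneg add_increasing add_increasing2)
  also have "\<dots> = 2 * (LINT x|lborel. heat_kernel 1 (x::'a))"
    by (simp add: lborel_translation i)
  finally show ?thesis using heat_L1_modulus_nonneg[of z] by simp
qed

lemma tendsto_scaled_zero:
  "((\<lambda>t. y /\<^sub>R sqrt t) \<longlongrightarrow> (0::'a::euclidean_space)) at_top"
proof -
  have "((\<lambda>t. inverse (sqrt t) *\<^sub>R y) \<longlongrightarrow> 0 *\<^sub>R y) at_top"
    by (intro tendsto_scaleR tendsto_const tendsto_inverse_0_at_top sqrt_at_top)
  then show ?thesis by simp
qed

text \<open>Continuity of translations in L1, here by dominated convergence: all translates of the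
  kernel by vectors of norm at most 1 lie below one wider Gaussian.\<close>

lemma tendsto_heat_L1_modulus:
  fixes y :: "'a::euclidean_space"
  shows "((\<lambda>t. heat_L1_modulus (y /\<^sub>R sqrt t)) \<longlongrightarrow> 0) at_top"
proof -
  \<comment> \<open>For |z| <= 1, |x|^2 <= 2|x-z|^2 + 2 yields -|x-z|^2/4 <= 1/4 - |x|^2/8, which
    explains 1/4 and 1/8. The factor 2 pays for the two kernels in the difference.\<close>
  define w where "w x = 2 * (4 * pi) powr (- (real DIM('a) / 2)) *
    (exp (1 / 4) * exp (- (1 / 8) * (norm x)\<^sup>2))" for x :: 'a
  have "((\<lambda>t. LINT x|lborel. \<bar>heat_kernel 1 (x - y /\<^sub>R sqrt t) - heat_kernel 1 x\<bar>)
      \<longlongrightarrow> (LINT x|(lborel :: 'a measure). 0)) at_top"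
  proof (rule integral_dominated_convergence_at_top)
    show "integrable lborel w"
      unfolding w_def using integrable_gaussian_euclidean[of "1/8"] by simp
    have "((\<lambda>t. norm (y /\<^sub>R sqrt t)) \<longlongrightarrow> 0) at_top"
      using tendsto_norm[OF tendsto_scaled_zero] by simp
    then have "\<forall>\<^sub>F t in at_top. norm (y /\<^sub>R sqrt t) < 1"
      by (rule order_tendstoD) simp
    then show "\<forall>\<^sub>F t in at_top. AE x in lborel.
        norm \<bar>heat_kernel 1 (x - y /\<^sub>R sqrt t) - heat_kernel 1 x\<bar> \<le> w x"
    proof eventually_elim
      case (elim t)
      have b: "heat_kernel 1 (x - z) \<le> w x / 2" if z: "norm z \<le> 1" for x z :: 'a
      proof -
        have "(norm x)\<^sup>2 \<le> (norm (x - z) + norm z)\<^sup>2"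
          using norm_triangle_ineq[of "x - z" z] by (intro power_mono) auto
        also have "\<dots> \<le> 2 * (norm (x - z))\<^sup>2 + 2 * (norm z)\<^sup>2"
          using sum_squares_bound[of "norm (x - z)" "norm z"] by (simp add: power2_sum)
        also have "(norm z)\<^sup>2 \<le> 1" using z by (simp add: power_le_one)
        finally have "- (norm (x - z))\<^sup>2 / 4 \<le> 1 / 4 + (- (1 / 8) * (norm x)\<^sup>2)" by simp
        then have "exp (- (norm (x - z))\<^sup>2 / 4) \<le> exp (1 / 4) * exp (- (1 / 8) * (norm x)\<^sup>2)"
          unfolding exp_add[symmetric] by simp
        then show ?thesis by (simp add: w_def heat_kernel_def)
      qed
      show ?case
      proof (rule AE_I2)
        fix x :: 'a
        show "norm \<bar>heat_kernel 1 (x - y /\<^sub>R sqrt t) - heat_kernel 1 x\<bar> \<le> w x"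
          \<comment> \<open>The translated kernel and, with z = 0, the untranslated one are each at
            most \<open>w x / 2\<close>.\<close>
          using b[of "y /\<^sub>R sqrt t" x] b[of 0 x] elim
            heat_kernel_nonneg[of 1 x] heat_kernel_nonneg[of 1 "x - y /\<^sub>R sqrt t"] by auto
      qed
    qed
    show "AE x in lborel. ((\<lambda>t. \<bar>heat_kernel 1 (x - y /\<^sub>R sqrt t) - heat_kernel 1 x\<bar>) \<longlongrightarrow> 0) at_top"
    proof (rule AE_I2)
      fix x :: 'a
      show "((\<lambda>t. \<bar>heat_kernel 1 (x - y /\<^sub>R sqrt t) - heat_kernel 1 x\<bar>) \<longlongrightarrow> 0) at_top"
        using heat_kernel_1_diff_le[of x "y /\<^sub>R sqrt t" for t]
        by (intro tendsto_0_le[OF tendsto_scaled_zero[of y], where K=1] always_eventually)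
           (simp del: norm_scaleR)
    qed
  qed measurable
  then show ?thesis by (simp add: heat_L1_modulus_def)
qed

text \<open>Substituting x = s x' with s = \<open>sqrt t\<close>, the Jacobian s^N cancels the
  factor t^(-N/2) of the scaling law, and the shift y becomes y/s.\<close>

lemma nn_integral_heat_kernel_diff:
  fixes y :: "'a::euclidean_space"
  assumes "t > 0"
  shows "(\<integral>\<^sup>+x. ennreal \<bar>heat_kernel t (x - y) - heat_kernel t x\<bar> \<partial>lborel)
    = ennreal (heat_L1_modulus (y /\<^sub>R sqrt t))"
proof -
  define s where "s = sqrt t"
  define F where "F x = ennreal \<bar>heat_kernel t (x - y) - heat_kernel t x\<bar>" for x :: 'a
  have s: "s > 0" using assms by (simp add: s_def)
  \<comment> \<open>The kernel carries a real power of t, the affine change of variables a natural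
    power of s; this reconciles them.\<close>
  have pw: "t powr (- (real DIM('a) / 2)) = inverse (s ^ DIM('a))"
  proof -
    have "s ^ DIM('a) = (t powr (1/2)) powr real DIM('a)"
      using s assms by (simp add: powr_realpow powr_half_sqrt s_def)
    then show ?thesis by (simp add: powr_powr powr_minus)
  qed
  have F: "F (s *\<^sub>R x) =
      ennreal (inverse (s ^ DIM('a)) * \<bar>heat_kernel 1 (x - y /\<^sub>R s) - heat_kernel 1 x\<bar>)" for x
    using s heat_kernel_scaling[OF assms, of "s *\<^sub>R x - y"] heat_kernel_scaling[OF assms, of "s *\<^sub>R x"]
    unfolding F_def pw s_def[symmetric]
    by (simp add: abs_mult scaleR_diff_right flip: right_diff_distrib)
  have [measurable]: "F \<in> borel_measurable borel" unfolding F_def by measurable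
  have "(\<integral>\<^sup>+x. F x \<partial>lborel) =
      (\<integral>\<^sup>+x. F x \<partial>density (distr lborel borel (\<lambda>x. 0 + s *\<^sub>R x)) (\<lambda>_. ennreal (\<bar>s\<bar> ^ DIM('a))))"
    using lborel_affine[of s "0::'a"] s by simp
  also have "\<dots> = (\<integral>\<^sup>+x. ennreal (s ^ DIM('a)) * F (s *\<^sub>R x) \<partial>lborel)"
    using s by (simp add: nn_integral_density nn_integral_distr)
  also have "\<dots> = (\<integral>\<^sup>+x. ennreal \<bar>heat_kernel 1 (x - y /\<^sub>R s) - heat_kernel 1 x\<bar> \<partial>lborel)"
    using s by (intro nn_integral_cong) (simp add: F flip: ennreal_mult')
  also have "\<dots> = ennreal (heat_L1_modulus (y /\<^sub>R s))"
    unfolding heat_L1_modulus_def by (rule nn_integral_eq_integral[OF integrable_heat_kernel_diff]) auto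
  finally show ?thesis by (simp add: F_def s_def)
qed

section \<open>The difference from the multiple of the kernel, pointwise and in L1\<close>

lemma heat_difference_eq:
  fixes u :: "'a::euclidean_space \<Rightarrow> real"
  assumes u: "integrable lborel u" and t: "t > 0"
  shows "integrable lborel (\<lambda>y. (heat_kernel t (x - y) - heat_kernel t x) * u y)"
    and "(LINT y|lborel. heat_kernel t (x - y) * u y) - (LINT y|lborel. u y) * heat_kernel t x
      = (LINT y|lborel. (heat_kernel t (x - y) - heat_kernel t x) * u y)"
proof -
  have [measurable]: "u \<in> borel_measurable borel" using u by auto
  \<comment> \<open>For fixed t the kernel is bounded, so its product with the integrable
    \<open>u\<close> is integrable.\<close>
  have 1: "integrable lborel (\<lambda>y. heat_kernel t (x - y) * u y)"
  proof (rule Bochner_Integration.integrable_bound)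
    show "integrable lborel (\<lambda>y. (4 * pi * t) powr (- (real DIM('a) / 2)) * u y)"
      using u by simp
    show "AE y in lborel. norm (heat_kernel t (x - y) * u y)
        \<le> norm ((4 * pi * t) powr (- (real DIM('a) / 2)) * u y)"
      using heat_kernel_bounded[OF t, where 'a='a] heat_kernel_nonneg[of t, where 'a='a]
      by (intro AE_I2) (simp add: abs_mult mult_right_mono)
  qed simp
  have 2: "integrable lborel (\<lambda>y. heat_kernel t x * u y)" using u by simp
  show "integrable lborel (\<lambda>y. (heat_kernel t (x - y) - heat_kernel t x) * u y)"
    using Bochner_Integration.integrable_diff[OF 1 2] by (simp add: left_diff_distrib)
  show "(LINT y|lborel. heat_kernel t (x - y) * u y) - (LINT y|lborel. u y) * heat_kernel t x
      = (LINT y|lborel. (heat_kernel t (x - y) - heat_kernel t x) * u y)"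
    using Bochner_Integration.integral_diff[OF 1 2] by (simp add: left_diff_distrib mult.commute[of "integral\<^sup>L lborel u"])
qed

text \<open>Scaling reduces the kernel difference to time 1 with shift y / \<open>sqrt t\<close>.
  The cap 1 in the weight keeps the integral finite even when \<open>u\<close> has no finite first
  moment.\<close>

lemma heat_difference_pointwise_bound:
  fixes u :: "'a::euclidean_space \<Rightarrow> real"
  assumes u: "integrable lborel u" and t: "t > 0"
  shows "\<bar>LINT y|lborel. (heat_kernel t (x - y) - heat_kernel t x) * u y\<bar>
    \<le> t powr (- (real DIM('a) / 2)) * (LINT y|lborel. min 1 (norm (y /\<^sub>R sqrt t)) * \<bar>u y\<bar>)"
proof -
  have [measurable]: "u \<in> borel_measurable borel" using u by auto
  let ?c = "t powr (- (real DIM('a) / 2))"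
  have int: "integrable lborel (\<lambda>y. min 1 (norm (y /\<^sub>R sqrt t)) * \<bar>u y\<bar>)"
    by (rule Bochner_Integration.integrable_bound[OF u]) (auto simp: abs_mult intro!: mult_left_le_one_le)
  have "\<bar>heat_kernel t (x - y) - heat_kernel t x\<bar> \<le> ?c * min 1 (norm (y /\<^sub>R sqrt t))" for y
  proof -
    have "\<bar>heat_kernel t (x - y) - heat_kernel t x\<bar>
        = ?c * \<bar>heat_kernel 1 (x /\<^sub>R sqrt t - y /\<^sub>R sqrt t) - heat_kernel 1 (x /\<^sub>R sqrt t)\<bar>"
      using heat_kernel_scaling[OF t, of "x - y"] heat_kernel_scaling[OF t, of x]
      by (simp add: abs_mult scaleR_diff_right flip: right_diff_distrib)
    also have "\<dots> \<le> ?c * min 1 (norm (y /\<^sub>R sqrt t))"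
      by (intro mult_left_mono heat_kernel_1_diff_le) simp
    finally show ?thesis .
  qed
  then have le: "\<bar>(heat_kernel t (x - y) - heat_kernel t x) * u y\<bar>
      \<le> ?c * (min 1 (norm (y /\<^sub>R sqrt t)) * \<bar>u y\<bar>)" for y
    unfolding abs_mult mult.assoc[symmetric] by (intro mult_right_mono) auto
  have "\<bar>LINT y|lborel. (heat_kernel t (x - y) - heat_kernel t x) * u y\<bar>
      \<le> (LINT y|lborel. \<bar>(heat_kernel t (x - y) - heat_kernel t x) * u y\<bar>)"
    by (rule integral_abs_bound)
  also have "\<dots> \<le> (LINT y|lborel. ?c * (min 1 (norm (y /\<^sub>R sqrt t)) * \<bar>u y\<bar>))"
    by (intro integral_mono integrable_abs heat_difference_eq(1) u t integrable_mult_right int le)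
  finally show ?thesis by simp
qed

text \<open>Move the absolute value inside and apply Tonelli: for fixed y the integral over x is
  exactly the rescaled modulus.\<close>

lemma heat_difference_L1_bound:
  fixes u :: "'a::euclidean_space \<Rightarrow> real"
  assumes u: "integrable lborel u" and t: "t > 0"
  shows "(\<integral>\<^sup>+x. ennreal \<bar>LINT y|lborel. (heat_kernel t (x - y) - heat_kernel t x) * u y\<bar> \<partial>lborel)
    \<le> ennreal (LINT y|lborel. heat_L1_modulus (y /\<^sub>R sqrt t) * \<bar>u y\<bar>)"
proof -
  have [measurable]: "u \<in> borel_measurable borel" using u by auto
  let ?D = "\<lambda>x y. heat_kernel t (x - y) - heat_kernel t x"
  let ?C = "2 * (LINT x|lborel. heat_kernel 1 (x::'a))"
  have int: "integrable lborel (\<lambda>y. heat_L1_modulus (y /\<^sub>R sqrt t) * \<bar>u y\<bar>)"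
  proof (rule Bochner_Integration.integrable_bound)
    show "integrable lborel (\<lambda>y. ?C * u y)" using u by simp
    show "AE y in lborel. norm (heat_L1_modulus (y /\<^sub>R sqrt t) * \<bar>u y\<bar>) \<le> norm (?C * u y)"
      unfolding real_norm_def abs_mult[of _ "\<bar>u _\<bar>"] abs_mult[of _ "u _"] abs_idempotent
      by (intro AE_I2 mult_right_mono order_trans[OF heat_L1_modulus_bounded abs_ge_self]) simp
  qed simp
  have "(\<integral>\<^sup>+x. ennreal \<bar>LINT y|lborel. ?D x y * u y\<bar> \<partial>lborel)
      \<le> (\<integral>\<^sup>+x. \<integral>\<^sup>+y. ennreal (\<bar>?D x y\<bar> * \<bar>u y\<bar>) \<partial>lborel \<partial>lborel)"
    using integral_norm_bound_ennreal[OF heat_difference_eq(1)[OF u t]]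
    by (intro nn_integral_mono) (simp add: abs_mult)
  also have "\<dots> = (\<integral>\<^sup>+y. \<integral>\<^sup>+x. ennreal (\<bar>?D x y\<bar> * \<bar>u y\<bar>) \<partial>lborel \<partial>lborel)"
    by (rule lborel_pair.Fubini'[symmetric]) measurable
  also have "\<dots> = (\<integral>\<^sup>+y. ennreal (heat_L1_modulus (y /\<^sub>R sqrt t) * \<bar>u y\<bar>) \<partial>lborel)"
    by (intro nn_integral_cong)
       (simp add: ennreal_mult nn_integral_multc nn_integral_heat_kernel_diff[OF t] heat_L1_modulus_nonneg)
  also have "\<dots> = ennreal (LINT y|lborel. heat_L1_modulus (y /\<^sub>R sqrt t) * \<bar>u y\<bar>)"
    by (rule nn_integral_eq_integral[OF int]) (simp add: heat_L1_modulus_nonneg)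
  finally show ?thesis .
qed

text \<open>Dominated convergence with majorant C|u|, stated for a general weight \<open>W\<close>
  so that it serves both endpoint cases.\<close>

lemma tendsto_integral_scaled_zero:
  fixes u :: "'a::euclidean_space \<Rightarrow> real" and W :: "'a \<Rightarrow> real"
  assumes u: "integrable lborel u" and [measurable]: "W \<in> borel_measurable borel"
    and bd: "\<And>z. \<bar>W z\<bar> \<le> C"
    and lim: "\<And>y. ((\<lambda>t. W (y /\<^sub>R sqrt t)) \<longlongrightarrow> 0) at_top"
  shows "((\<lambda>t. LINT y|lborel. W (y /\<^sub>R sqrt t) * \<bar>u y\<bar>) \<longlongrightarrow> 0) at_top"
proof -
  have [measurable]: "u \<in> borel_measurable borel" using u by auto
  have "((\<lambda>t. LINT y|lborel. W (y /\<^sub>R sqrt t) * \<bar>u y\<bar>) \<longlongrightarrow> (LINT y|(lborel :: 'a measure). 0)) at_top"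
  proof (rule integral_dominated_convergence_at_top)
    show "integrable lborel (\<lambda>y. C * \<bar>u y\<bar>)" using u by simp
    show "\<forall>\<^sub>F t in at_top. AE y in lborel. norm (W (y /\<^sub>R sqrt t) * \<bar>u y\<bar>) \<le> C * \<bar>u y\<bar>"
      using bd by (intro always_eventually allI AE_I2) (simp add: abs_mult mult_right_mono)
    show "AE y in lborel. ((\<lambda>t. W (y /\<^sub>R sqrt t) * \<bar>u y\<bar>) \<longlongrightarrow> 0) at_top"
      by (intro AE_I2 tendsto_mult_left_zero lim)
  qed measurable
  then show ?thesis by simp
qed

section \<open>Bounds for the Lp norms\<close>

lemma Lp_norm_1_le:
  assumes [measurable]: "f \<in> borel_measurable M"
    and le: "(\<integral>\<^sup>+x. ennreal \<bar>f x\<bar> \<partial>M) \<le> ennreal A"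
  shows "Lp_norm M 1 f \<le> ennreal A"
  using le le_less_trans[OF le ennreal_less_top] assms(1) by (simp add: Lp_norm_def)

lemma Lp_norm_infinity_le:
  assumes [measurable]: "f \<in> borel_measurable M" and "\<And>x. \<bar>f x\<bar> \<le> B"
  shows "Lp_norm M \<infinity> f \<le> ennreal B"
  unfolding Lp_norm_def using assms by (auto intro!: esssup_I ennreal_leI)

text \<open>Interpolation between L1 and the sup norm: |f|^q <= B^(q-1) |f| pointwise; then
  integrate and take the root.\<close>

lemma Lp_norm_interpolation:
  assumes [measurable]: "f \<in> borel_measurable M" and "0 \<le> A"
    and le: "(\<integral>\<^sup>+x. ennreal \<bar>f x\<bar> \<partial>M) \<le> ennreal A" and B: "\<And>x. \<bar>f x\<bar> \<le> B"
    and q: "1 < q"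
  shows "Lp_norm M (ennreal q) f \<le> ennreal ((B powr (q - 1) * A) powr (1 / q))"
proof -
  let ?I = "\<integral>\<^sup>+x. ennreal (\<bar>f x\<bar> powr q) \<partial>M"
  have pw: "\<bar>f x\<bar> powr q \<le> B powr (q - 1) * \<bar>f x\<bar>" for x
  proof (cases "f x = 0")
    case False
    then have "\<bar>f x\<bar> powr q = \<bar>f x\<bar> powr (q - 1) * \<bar>f x\<bar>"
      using powr_add[of "\<bar>f x\<bar>" "q - 1" 1] by simp
    also have "\<dots> \<le> B powr (q - 1) * \<bar>f x\<bar>"
      using B[of x] q by (intro mult_right_mono powr_mono2) auto
    finally show ?thesis .
  qed simp
  have "?I \<le> (\<integral>\<^sup>+x. ennreal (B powr (q - 1)) * ennreal \<bar>f x\<bar> \<partial>M)"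
    by (intro nn_integral_mono) (simp add: pw flip: ennreal_mult)
  also have "\<dots> = ennreal (B powr (q - 1)) * (\<integral>\<^sup>+x. ennreal \<bar>f x\<bar> \<partial>M)"
    by (rule nn_integral_cmult) measurable
  also have "\<dots> \<le> ennreal (B powr (q - 1) * A)"
    using le \<open>0 \<le> A\<close> by (simp add: ennreal_mult mult_left_mono)
  finally have I: "?I \<le> ennreal (B powr (q - 1) * A)" .
  \<comment> \<open>Finiteness selects the branch of \<open>Lp_norm\<close> that takes the q-th
    root, and makes \<open>enn2real\<close> faithful.\<close>
  then have fin: "?I < \<infinity>" using le_less_trans[OF I ennreal_less_top] by simp
  have "enn2real ?I \<le> B powr (q - 1) * A"
    using I \<open>0 \<le> A\<close> by (simp add: enn2real_leI)
  then have "enn2real ?I powr (1 / q) \<le> (B powr (q - 1) * A) powr (1 / q)"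
    using q by (intro powr_mono2) auto
  then show ?thesis
    using q fin by (simp add: Lp_norm_def ennreal_leI)
qed

lemma tendsto_ennreal_0_sandwich:
  fixes f :: "real \<Rightarrow> ennreal"
  assumes "(g \<longlongrightarrow> 0) at_top" and "\<And>t. t > 0 \<Longrightarrow> f t \<le> ennreal (g t)"
  shows "(f \<longlongrightarrow> 0) at_top"
proof (rule tendsto_sandwich[OF _ _ tendsto_const])
  show "\<forall>\<^sub>F t in at_top. f t \<le> ennreal (g t)"
    using eventually_gt_at_top[of 0] by eventually_elim (rule assms(2))
  show "((\<lambda>t. ennreal (g t)) \<longlongrightarrow> 0) at_top"
    using tendsto_ennrealI[OF assms(1)] by simp
qed simp

theorem theorem2p1:
  fixes u0 :: "'a::euclidean_space \<Rightarrow> real" and M :: real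
  assumes "integrable lebesgue u0"
    and "M = (LINT x|lebesgue. u0 x)"
  shows "((\<lambda>t. Lp_norm lebesgue 1 (\<lambda>x. heat_solution u0 t x - M * heat_kernel t x))
            \<longlongrightarrow> 0) at_top \<and>
         ((\<lambda>t. ennreal (t powr (real DIM('a) / 2)) *
               Lp_norm lebesgue \<infinity> (\<lambda>x. heat_solution u0 t x - M * heat_kernel t x))
            \<longlongrightarrow> 0) at_top \<and>
         (\<forall>p\<ge>1.
           ((\<lambda>t. ennreal (t powr decay_exponent DIM('a) p) *
                 Lp_norm lebesgue p (\<lambda>x. heat_solution u0 t x - M * heat_kernel t x))
              \<longlongrightarrow> 0) at_top)"
proof -
  \<comment> \<open>Replace \<open>u0\<close> by a Borel function equal to it almost everywhere, so
    that the estimates over \<open>lborel\<close> apply; the mass \<open>M\<close> is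
    unchanged.\<close>
  have "u0 \<in> borel_measurable lebesgue" using assms(1) by auto
  then obtain u where u_meas [measurable]: "u \<in> borel_measurable lborel"
    and "AE x in lborel. u0 x = u x"
    using completion_ex_borel_measurable_real by blast
  then have eq: "AE x in lebesgue. u0 x = u x" by (intro AE_completion)
  have u_meas' [measurable]: "u \<in> borel_measurable borel" using u_meas by simp
  have u_leb [measurable]: "u \<in> borel_measurable lebesgue" by (rule measurable_completion[OF u_meas])
  have u: "integrable lborel u"
    using assms(1) integrable_cong_AE[OF _ u_leb eq] integrable_completion[OF u_meas] by auto
  have M: "M = (LINT x|lborel. u x)"
    using assms integral_cong_AE[OF _ u_leb eq] integral_completion[OF u_meas] by auto
  \<comment> \<open>An identity at every x, not only almost every x: the convolution integral
    ignores null sets in y.\<close>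
  have sol: "heat_solution u0 t x = (LINT y|lborel. heat_kernel t (x - y) * u y)" for t x
  proof -
    have k: "(\<lambda>y. heat_kernel t (x - y)) \<in> borel_measurable lebesgue"
      by (rule measurable_completion) simp
    have "heat_solution u0 t x = (LINT y|lebesgue. heat_kernel t (x - y) * u y)"
      unfolding heat_solution_def using eq assms(1)
      by (intro integral_cong_AE borel_measurable_times k u_leb) auto
    also have "\<dots> = (LINT y|lborel. heat_kernel t (x - y) * u y)"
      by (rule integral_completion) simp
    finally show ?thesis .
  qed
  define f where "f t x = heat_solution u0 t x - M * heat_kernel t x" for t x
  \<comment> \<open>\<open>A t\<close> will bound the L1 norm of \<open>f t\<close>, and
    \<open>B t\<close> will bound t^(N/2) times its sup norm.\<close>
  define A where "A t = (LINT y|lborel. heat_L1_modulus (y /\<^sub>R sqrt t) * \<bar>u y\<bar>)" for t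
  define B where "B t = (LINT y|lborel. min 1 (norm (y /\<^sub>R sqrt t)) * \<bar>u y\<bar>)" for t
  let ?d = "real DIM('a) / 2"
  have A0: "0 \<le> A t" for t unfolding A_def by (simp add: heat_L1_modulus_nonneg)
  have B0: "0 \<le> B t" for t unfolding B_def by simp
  have fD: "f t x = (LINT y|lborel. (heat_kernel t (x - y) - heat_kernel t x) * u y)"
    if "t > 0" for t x
    unfolding f_def sol M using heat_difference_eq(2)[OF u that] .
  have meas: "f t \<in> borel_measurable lebesgue" for t
    unfolding f_def[abs_def] sol by (rule measurable_completion) measurable
  have fB: "\<bar>f t x\<bar> \<le> t powr (- ?d) * B t" if "t > 0" for t x
    unfolding fD[OF that] B_def by (rule heat_difference_pointwise_bound[OF u that])
  have fA: "(\<integral>\<^sup>+x. ennreal \<bar>f t x\<bar> \<partial>lebesgue) \<le> ennreal (A t)" if "t > 0" for t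
    unfolding nn_integral_completion fD[OF that] A_def
    by (rule heat_difference_L1_bound[OF u that])
  have A: "(A \<longlongrightarrow> 0) at_top"
    unfolding A_def[abs_def]
    by (rule tendsto_integral_scaled_zero[OF u heat_L1_modulus_measurable heat_L1_modulus_bounded
        tendsto_heat_L1_modulus])
  have B: "(B \<longlongrightarrow> 0) at_top"
    unfolding B_def[abs_def]
  proof (rule tendsto_integral_scaled_zero[OF u, where C=1])
    show "((\<lambda>t. min 1 (norm (y /\<^sub>R sqrt t))) \<longlongrightarrow> 0) at_top" for y :: 'a
      by (rule tendsto_0_le[OF tendsto_scaled_zero[of y], where K=1]) auto
  qed auto
  have L1: "((\<lambda>t. Lp_norm lebesgue 1 (f t)) \<longlongrightarrow> 0) at_top"
    by (rule tendsto_ennreal_0_sandwich[OF A Lp_norm_1_le[OF meas fA]])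
  have Linf: "((\<lambda>t. ennreal (t powr ?d) * Lp_norm lebesgue \<infinity> (f t)) \<longlongrightarrow> 0) at_top"
  proof (rule tendsto_ennreal_0_sandwich[OF B])
    fix t :: real assume t: "t > 0"
    have "ennreal (t powr ?d) * Lp_norm lebesgue \<infinity> (f t)
        \<le> ennreal (t powr ?d) * ennreal (t powr (- ?d) * B t)"
      by (intro mult_left_mono Lp_norm_infinity_le meas fB t) simp
    also have "\<dots> = ennreal (B t)"
      using t by (simp add: powr_minus mult.assoc[symmetric] flip: ennreal_mult')
    finally show "ennreal (t powr ?d) * Lp_norm lebesgue \<infinity> (f t) \<le> ennreal (B t)" .
  qed
  have Lp: "((\<lambda>t. ennreal (t powr decay_exponent DIM('a) p) * Lp_norm lebesgue p (f t)) \<longlongrightarrow> 0) at_top"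
    if p: "1 \<le> p" for p
  proof -
    consider "p = \<infinity>" | "p = 1" | q where "p = ennreal q" "1 < q"
      using p by (cases p) (auto simp: ennreal_1[symmetric] simp del: ennreal_1 intro: order_le_neq_trans)
    then show ?thesis
    proof cases
      case 1
      then show ?thesis using Linf by (simp add: decay_exponent_def)
    next
      case 2
      show ?thesis
      \<comment> \<open>The exponent is 0, but \<open>t powr 0\<close> is 1 only for nonzero t, so
        the two functions agree only eventually.\<close>
      proof (rule Lim_transform_eventually[OF L1])
        show "\<forall>\<^sub>F t in at_top. Lp_norm lebesgue 1 (f t) =
            ennreal (t powr decay_exponent DIM('a) p) * Lp_norm lebesgue p (f t)"
          using eventually_gt_at_top[of 0] by eventually_elim (simp add: 2 decay_exponent_def)
      qed
    next
      case (3 q)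
      have e: "decay_exponent DIM('a) p = ?d * (q - 1) / q"
        using 3 by (simp add: decay_exponent_def)
      \<comment> \<open>The exponent q - 1 is positive here, as p = 1 has been split off.\<close>
      have "((\<lambda>t. B t powr (q - 1)) \<longlongrightarrow> 0) at_top"
        using B0 3 by (intro tendsto_zero_powrI[OF B tendsto_const]) auto
      then have "((\<lambda>t. (B t powr (q - 1) * A t) powr (1 / q)) \<longlongrightarrow> 0) at_top"
        using A0 3 by (intro tendsto_zero_powrI[OF tendsto_mult_zero[OF _ A] tendsto_const]) auto
      then show ?thesis
      proof (rule tendsto_ennreal_0_sandwich)
        fix t :: real assume t: "t > 0"
        \<comment> \<open>Under the q-th root the weight becomes t^(d(q-1)), d = N/2, and cancels
          the factor (t^(-d))^(q-1) from the sup bound.\<close>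
        have "t powr (?d * (q - 1) / q) * (((t powr (- ?d) * B t) powr (q - 1) * A t) powr (1 / q))
            = (t powr (?d * (q - 1)) * ((t powr (- ?d) * B t) powr (q - 1) * A t)) powr (1 / q)"
          using A0[of t] by (simp add: powr_mult powr_powr)
        also have "t powr (?d * (q - 1)) * ((t powr (- ?d) * B t) powr (q - 1) * A t)
            = (t powr (?d * (q - 1)) * t powr (- (?d * (q - 1)))) * (B t powr (q - 1) * A t)"
          using B0[of t] by (simp add: powr_mult powr_powr)
        also have "t powr (?d * (q - 1)) * t powr (- (?d * (q - 1))) = 1"
          using t by (simp flip: powr_add)
        also have "(1 * (B t powr (q - 1) * A t)) powr (1 / q) = (B t powr (q - 1) * A t) powr (1 / q)"
          by simp
        finally have *: "t powr (?d * (q - 1) / q) * (((t powr (- ?d) * B t) powr (q - 1) * A t) powr (1 / q))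
            = (B t powr (q - 1) * A t) powr (1 / q)" .
        have "ennreal (t powr decay_exponent DIM('a) p) * Lp_norm lebesgue p (f t)
            \<le> ennreal (t powr (?d * (q - 1) / q)) *
              ennreal (((t powr (- ?d) * B t) powr (q - 1) * A t) powr (1 / q))"
          unfolding e unfolding 3(1) by (intro mult_left_mono Lp_norm_interpolation meas A0 fA fB t 3) simp
        also have "\<dots> = ennreal ((B t powr (q - 1) * A t) powr (1 / q))"
          by (simp only: * ennreal_mult'[symmetric] powr_ge_zero)
        finally show "ennreal (t powr decay_exponent DIM('a) p) * Lp_norm lebesgue p (f t)
            \<le> ennreal ((B t powr (q - 1) * A t) powr (1 / q))" .
      qed
    qed
  qed
  show ?thesis
    using L1 Linf Lp unfolding f_def[abs_def] by blast
qed

end
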